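(* Let $d\ge1$ and $n$ be integers with $d\le n-1$, let $\kappa>0$, and let $D=[d_{ij}]\in\mathbb R_{\ge0}^{n\times n}$ be a symmetric matrix with zero diagonal. Let $X\in\mathbb R^{n\times(d+1)}$ be the matrix returned by $\texttt{hydra}(D,d,\kappa)$ and let $x_1,\dots,x_n$ be its rows. Then $(x_1,\dots,x_n)$ is a globally optimal solution of the strain minimization problem $$\min_{y_1,\dots,y_n\in\mathbb R^{1,d}}\ \sum_{i,j=1}^n\big(\cosh(\sqrt\kappa\,d_{ij})-y_i\circ y_j\big)^2.$$ Moreover, the first column of $X$ is strictly positive; equivalently, all $x_i$ are elements of the positive Lorentz space $\mathbb R^{1,d}_+$.
   Context: Lorentz product on $\mathbb R^{d+1}$: $x\circ y:=x_1y_1-(x_2y_2+\dots+x_{d+1}y_{d+1})$. The space $\mathbb R^{d+1}$ with this product is denoted $\mathbb R^{1,d}$, and $\mathbb R^{1,d}_+=\{x\in\mathbb R^{1,d}:x_1>0\}$ is the positive Lorentz space. The matrix $X$ returned by $\texttt{hydra}(D,d,\kappa)$ is defined as follows. Set $A=[\cosh(\sqrt\kappa\,d_{ij})]\in\mathbb R^{n\times n}$ and take an eigendecomposition $A=Q\Lambda Q^\top$ with $Q$ orthogonal, $\Lambda=\operatorname{diag}(\lambda_1,\dots,\lambda_n)$, $\lambda_1\ge\dots\ge\lambda_n$, and columns $q_1,\dots,q_n$ of $Q$ the corresponding eigenvectors; $q_1$ is the Perron–Frobenius eigenvector of the entrywise positive matrix $A$, i.e. of the two possible signs for $q_1$ the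 one with nonnegative entries is chosen. Then $$X:=\left[\sqrt{\lambda_1}\,q_1\quad\sqrt{(-\lambda_{n-d+1})^+}\,q_{n-d+1}\quad\cdots\quad\sqrt{(-\lambda_n)^+}\,q_n\right]\in\mathbb R^{n\times(d+1)},$$ where $x^+=\max(x,0)$. *)

theory Defs
  imports Complex_Main "Jordan_Normal_Form.Matrix"
begin

(* Vectors and matrices are indexed from 0, so that the time-like coordinate
   x_1 of R^{1,d} is x $ 0 and the space-like ones are x $ 1, ..., x $ d. *)

definition lorentz_prod :: "real vec \<Rightarrow> real vec \<Rightarrow> real" (infixl \<open>\<circ>\<^sub>L\<close> 70) where
  "x \<circ>\<^sub>L y = x $ 0 * y $ 0 - (\<Sum>k = 1..<dim_vec x. x $ k * y $ k)"

definition lorentz_space :: "nat \<Rightarrow> real vec set" where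
  "lorentz_space d = carrier_vec (d + 1)"

definition pos_lorentz_space :: "nat \<Rightarrow> real vec set" where
  "pos_lorentz_space d = {x \<in> lorentz_space d. x $ 0 > 0}"

definition cosh_mat :: "real \<Rightarrow> real mat \<Rightarrow> real mat" where
  "cosh_mat \<kappa> D = map_mat (\<lambda>t. cosh (sqrt \<kappa> * t)) D"

definition strain :: "real \<Rightarrow> nat \<Rightarrow> real mat \<Rightarrow> (nat \<Rightarrow> real vec) \<Rightarrow> real" where
  "strain \<kappa> n D y = (\<Sum>i<n. \<Sum>j<n. (cosh (sqrt \<kappa> * D $$ (i, j)) - y i \<circ>\<^sub>L y j)\<^sup>2)"

definition ordered_eigendecomposition ::
    "nat \<Rightarrow> real mat \<Rightarrow> real mat \<Rightarrow> (nat \<Rightarrow> real) \<Rightarrow> bool" where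
  "ordered_eigendecomposition n A Q lam \<longleftrightarrow>
     Q \<in> carrier_mat n n \<and>
     transpose_mat Q * Q = 1\<^sub>m n \<and>
     A = Q * mat_diag n lam * transpose_mat Q \<and>
     (\<forall>i j. i \<le> j \<longrightarrow> j < n \<longrightarrow> lam j \<le> lam i)"

(* Column k = 1, ..., d uses the 1-based eigenpair number n - d + k,
   that is, the 0-based one n - d + k - 1. *)
definition hydra_mat :: "nat \<Rightarrow> nat \<Rightarrow> real mat \<Rightarrow> (nat \<Rightarrow> real) \<Rightarrow> real mat" where
  "hydra_mat n d Q lam = mat n (d + 1) (\<lambda>(i, k).
     if k = 0 then sqrt (lam 0) * Q $$ (i, 0)
     else sqrt (max (- lam (n - d + k - 1)) 0) * Q $$ (i, n - d + k - 1))"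

(* hydra is a relation rather than a function because the eigendecomposition is
   not unique (eigenvalues may be repeated and the signs of eigenvectors are
   free). Only the sign of the first eigenvector is prescribed. *)
definition hydra :: "nat \<Rightarrow> real mat \<Rightarrow> nat \<Rightarrow> real \<Rightarrow> real mat \<Rightarrow> bool" where
  "hydra n D d \<kappa> X \<longleftrightarrow>
     (\<exists>Q lam. ordered_eigendecomposition n (cosh_mat \<kappa> D) Q lam \<and>
        (\<forall>i<n. Q $$ (i, 0) \<ge> 0) \<and>
        X = hydra_mat n d Q lam)"

end

theory Submission
  imports Defs "Jordan_Normal_Form.Determinant"
begin

text \<open>
  Since the Frobenius norm is invariant under orthogonal conjugation, the strain of a configuration
  is the squared norm of $B = \Lambda - u u^T + \sum_{k<d} v_k v_k^T$, where $u, v_0, \dots, v_{d-1}$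
  are the coordinate columns expressed in the eigenbasis. For every $Z$ one has
  $\|B\|^2 \ge 2 \langle B, Z\rangle - \|Z\|^2$. Take $Z = P - N$ with $P$, $N$ positive semidefinite,
  $P$ vanishing on $u$ and $N$ vanishing on all $v_k$; the unknown rank-one terms then only help, and
  the bound decouples. For $P$, choose orthonormal $f_j$ in the span of $e_0, \dots, e_j$ orthogonal to
  $u$ (for $j \ge 1$) and put $P = \sum_j \lambda_j^+ f_j f_j^T$; as $\langle f_j, \Lambda f_j\rangle \ge
  \lambda_j$, this gives $\langle \Lambda, P\rangle \ge \|P\|^2 = \sum_{j \ge 1} (\lambda_j^+)^2$.
  The matrix $N$ arises in the same way from $-\Lambda$ in reversed order, and the configuration
  returned by hydra attains the resulting bound. Positivity of the first column is the
  Perron-Frobenius argument: $\lambda_0 q_0 = A q_0$ is strictly positive as $A$ is.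
\<close>

section \<open>Orthonormal vectors under linear constraints\<close>

definition dot :: "nat \<Rightarrow> (nat \<Rightarrow> real) \<Rightarrow> (nat \<Rightarrow> real) \<Rightarrow> real" where
  "dot n x y = (\<Sum>i<n. x i * y i)"

text \<open>The Frobenius inner product. Paired with \<open>outer x\<close> it gives the quadratic
  form of \<open>M\<close> at \<open>x\<close>, so positive semidefiniteness is expressed below as
  nonnegativity against all \<open>outer x\<close>.\<close>

definition finner :: "nat \<Rightarrow> (nat \<Rightarrow> nat \<Rightarrow> real) \<Rightarrow> (nat \<Rightarrow> nat \<Rightarrow> real) \<Rightarrow> real" where
  "finner n M N = (\<Sum>i<n. \<Sum>j<n. M i j * N i j)"

definition outer :: "(nat \<Rightarrow> real) \<Rightarrow> nat \<Rightarrow> nat \<Rightarrow> real" where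
  "outer x = (\<lambda>i j. x i * x j)"

definition diag :: "(nat \<Rightarrow> real) \<Rightarrow> nat \<Rightarrow> nat \<Rightarrow> real" where
  "diag lam = (\<lambda>i j. if i = j then lam i else 0)"

text \<open>Padding the N equations in N + 1 unknowns with a zero row gives a square matrix of
  determinant 0, hence a nonzero kernel vector, which is then extended by zero.\<close>

lemma homogeneous_system_nontrivial_solution:
  fixes h :: "nat \<Rightarrow> nat \<Rightarrow> real"
  shows "\<exists>x. (\<exists>i\<le>N. x i \<noteq> 0) \<and> (\<forall>i>N. x i = 0) \<and> (\<forall>k<N. (\<Sum>i\<le>N. h k i * x i) = 0)"
proof -
  define A where "A = mat (Suc N) (Suc N) (\<lambda>(k, i). if k < N then h k i else 0)"
  have A: "A \<in> carrier_mat (Suc N) (Suc N)" unfolding A_def by simp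
  have "row A N = 0\<^sub>v (Suc N)" unfolding A_def by (intro eq_vecI) auto
  hence "det A = (\<Sum>j<Suc N. A $$ (N, j) * cofactor A N j)"
    using laplace_expansion_row[OF A, of N] by simp
  also have "\<dots> = 0" unfolding A_def by (intro sum.neutral) auto
  finally have "det A = 0" .
  then obtain v where v: "v \<in> carrier_vec (Suc N)" "v \<noteq> 0\<^sub>v (Suc N)" "A *\<^sub>v v = 0\<^sub>v (Suc N)"
    using det_0_iff_vec_prod_zero_field[OF A] by auto
  define x where "x i = (if i \<le> N then v $ i else 0)" for i
  have "\<exists>i\<le>N. x i \<noteq> 0"
  proof (rule ccontr)
    assume "\<not> (\<exists>i\<le>N. x i \<noteq> 0)"
    hence "v = 0\<^sub>v (Suc N)" using v(1) by (intro eq_vecI) (auto simp: x_def)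
    with v(2) show False by simp
  qed
  moreover have "(\<Sum>i\<le>N. h k i * x i) = 0" if k: "k < N" for k
  proof -
    have "(A *\<^sub>v v) $ k = (\<Sum>i<Suc N. h k i * v $ i)"
      using k v(1) by (auto simp: A_def scalar_prod_def atLeast0LessThan intro!: sum.cong)
    also have "\<dots> = (\<Sum>i\<le>N. h k i * x i)"
      unfolding lessThan_Suc_atMost by (intro sum.cong) (auto simp: x_def)
    finally show ?thesis using v(3) k by simp
  qed
  ultimately show ?thesis by (intro exI[of _ x]) (auto simp: x_def)
qed

lemma dot_commute: "dot n x y = dot n y x"
  by (simp add: dot_def mult.commute)

lemma dot_scale: "dot n x (\<lambda>i. a * y i) = a * dot n x y"
  by (simp add: dot_def sum_distrib_left mult_ac)

lemma dot_truncate: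
  assumes "\<And>i. i > N \<Longrightarrow> x i = 0" and "N < n"
  shows "dot n h x = (\<Sum>i\<le>N. h i * x i)"
  unfolding dot_def using assms by (intro sum.mono_neutral_right) auto

text \<open>Induction on r by counting: the next vector may use m + r + 1 coordinates and faces m +
  r orthogonality conditions, m from the \<open>w k\<close> and r from the vectors already built.
  The staggered supports are what later bounds the quadratic forms by single eigenvalues.\<close>

lemma orthonormal_flag_avoiding:
  fixes w :: "nat \<Rightarrow> nat \<Rightarrow> real"
  assumes "m + r \<le> n"
  shows "\<exists>c. \<forall>a<r. (\<forall>i>m + a. c a i = 0) \<and> (\<forall>k<m. dot n (w k) (c a) = 0) \<and>
    (\<forall>b<r. dot n (c a) (c b) = (if a = b then 1 else 0))"
  using assms
proof (induction r)
  case 0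
  show ?case by simp
next
  case (Suc r)
  have "m + r \<le> n" using Suc.prems by simp
  from Suc.IH[OF this] obtain c where c: "\<And>a i. a < r \<Longrightarrow> i > m + a \<Longrightarrow> c a i = 0"
      "\<And>a k. a < r \<Longrightarrow> k < m \<Longrightarrow> dot n (w k) (c a) = 0"
      "\<And>a b. a < r \<Longrightarrow> b < r \<Longrightarrow> dot n (c a) (c b) = (if a = b then 1 else 0)"
    by blast
  define h where "h k = (if k < m then w k else c (k - m))" for k
  obtain x where x: "\<exists>i\<le>m + r. x i \<noteq> 0" "\<And>i. i > m + r \<Longrightarrow> x i = 0"
      "\<And>k. k < m + r \<Longrightarrow> (\<Sum>i\<le>m + r. h k i * x i) = 0"
    using homogeneous_system_nontrivial_solution[of "m + r" h] by blast
  have hx: "dot n (h k) x = 0" if "k < m + r" for k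
    using dot_truncate[of "m + r" x n "h k"] x(2,3) that Suc.prems by simp
  have wx: "dot n (w k) x = 0" if "k < m" for k
    using hx[of k] that by (simp add: h_def)
  have cx: "dot n (c a) x = 0" if "a < r" for a
    using hx[of "m + a"] that by (simp add: h_def)
  obtain i0 where i0: "i0 \<le> m + r" "x i0 \<noteq> 0" using x(1) by blast
  have "0 < x i0 * x i0" using i0(2) by (metis not_real_square_gt_zero)
  also have "\<dots> \<le> dot n x x"
    unfolding dot_def using i0 Suc.prems by (intro member_le_sum) auto
  finally have pos: "dot n x x > 0" .
  define y where "y i = 1 / sqrt (dot n x x) * x i" for i
  have wy: "dot n z y = 1 / sqrt (dot n x x) * dot n z x" for z
    unfolding y_def by (rule dot_scale)
  have "dot n y y = 1 / sqrt (dot n x x) * (1 / sqrt (dot n x x) * dot n x x)"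
    by (metis wy dot_commute)
  also have "\<dots> = 1" using pos by (simp add: field_simps)
  finally have yy: "dot n y y = 1" .
  have cy: "dot n (c a) y = 0" "dot n y (c a) = 0" if "a < r" for a
    using cx[OF that] wy[of "c a"] dot_commute by simp_all
  have wy0: "dot n (w k) y = 0" if "k < m" for k
    using wx[OF that] wy[of "w k"] by simp
  have y0: "y i = 0" if "i > m + r" for i
    using x(2)[OF that] by (simp add: y_def)
  have "\<forall>a<Suc r. (\<forall>i>m + a. (c(r := y)) a i = 0) \<and> (\<forall>k<m. dot n (w k) ((c(r := y)) a) = 0) \<and>
    (\<forall>b<Suc r. dot n ((c(r := y)) a) ((c(r := y)) b) = (if a = b then 1 else 0))"
    using c wy0 y0 yy cy by (auto simp: less_Suc_eq)
  thus ?case by blast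
qed

section \<open>Frobenius inner product and approximation of a diagonal matrix\<close>

lemma finner_commute: "finner n M N = finner n N M"
  by (simp add: finner_def mult.commute)

lemma finner_add: "finner n M (\<lambda>i j. N i j + K i j) = finner n M N + finner n M K"
  by (simp add: finner_def algebra_simps sum.distrib)

lemma finner_diff: "finner n M (\<lambda>i j. N i j - K i j) = finner n M N - finner n M K"
  by (simp add: finner_def algebra_simps sum_subtractf)

lemma finner_sum: "finner n M (\<lambda>i j. \<Sum>a\<in>S. t a * N a i j) = (\<Sum>a\<in>S. t a * finner n M (N a))"
proof -
  have "finner n M (\<lambda>i j. \<Sum>a\<in>S. t a * N a i j) =
      (\<Sum>i<n. \<Sum>j<n. \<Sum>a\<in>S. t a * (M i j * N a i j))"
    by (simp add: finner_def sum_distrib_left mult_ac)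
  also have "\<dots> = (\<Sum>i<n. \<Sum>a\<in>S. \<Sum>j<n. t a * (M i j * N a i j))"
    by (intro sum.cong refl sum.swap)
  also have "\<dots> = (\<Sum>a\<in>S. \<Sum>i<n. \<Sum>j<n. t a * (M i j * N a i j))"
    by (rule sum.swap)
  finally show ?thesis by (simp add: finner_def sum_distrib_left)
qed

lemma finner_outer_outer: "finner n (outer x) (outer y) = (dot n x y)\<^sup>2"
  by (simp add: finner_def outer_def dot_def power2_eq_square sum_product mult_ac)

lemma finner_diag_outer: "finner n (diag lam) (outer x) = (\<Sum>i<n. lam i * (x i)\<^sup>2)"
  by (simp add: finner_def diag_def outer_def power2_eq_square if_distribR if_distrib[of "\<lambda>u. u * _"]
      cong: if_cong)

lemma finner_self_lower_bound: "2 * finner n B Z - finner n Z Z \<le> finner n B B"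
proof -
  have "0 \<le> finner n (\<lambda>i j. B i j - Z i j) (\<lambda>i j. B i j - Z i j)"
    unfolding finner_def by (intro sum_nonneg) simp
  also have "\<dots> = finner n B B - 2 * finner n B Z + finner n Z Z"
    by (simp add: finner_diff finner_commute[of _ "\<lambda>i j. B i j - Z i j"])
      (simp add: finner_commute[of n Z B])
  finally show ?thesis by simp
qed

text \<open>Supplies the P of the overview. The first property says that \<open>Z\<close> lies in
  the cone spanned by the \<open>outer x\<close>; it will make the cross term between P and N
  nonnegative. Each of the m constraints costs one of the largest eigenvalues, so the sum starts at
  m.\<close>

lemma compressed_positive_part:
  fixes w :: "nat \<Rightarrow> nat \<Rightarrow> real"
  assumes desc: "antimono_on {..<n} lam" and m: "m \<le> n"
  defines "s \<equiv> (\<Sum>j=m..<n. (max (lam j) 0)\<^sup>2)"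
  obtains Z where
    "\<And>M. (\<And>x. 0 \<le> finner n M (outer x)) \<Longrightarrow> 0 \<le> finner n M Z"
    "\<And>x. 0 \<le> finner n Z (outer x)"
    "\<And>k. k < m \<Longrightarrow> finner n Z (outer (w k)) = 0"
    "s \<le> finner n (diag lam) Z"
    "finner n Z Z = s"
proof -
  obtain c where c: "\<And>a i. a < n - m \<Longrightarrow> i > m + a \<Longrightarrow> c a i = 0"
      "\<And>a k. a < n - m \<Longrightarrow> k < m \<Longrightarrow> dot n (w k) (c a) = 0"
      "\<And>a b. a < n - m \<Longrightarrow> b < n - m \<Longrightarrow> dot n (c a) (c b) = (if a = b then 1 else 0)"
    using orthonormal_flag_avoiding[of m "n - m" n w] m
    unfolding le_add_diff_inverse[OF m] by blast
  \<comment> \<open>The weight belongs to m + a, the last index at which \<open>c a\<close> may be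
    nonzero; as \<open>lam\<close> decreases, it is the smallest eigenvalue that \<open>c a\<close>
    can meet.\<close>
  define t where "t a = max (lam (m + a)) 0" for a
  have t: "t a \<ge> 0" for a by (simp add: t_def)
  define Z where "Z = (\<lambda>i j. \<Sum>a<n - m. t a * outer (c a) i j)"
  have Z: "finner n M Z = (\<Sum>a<n - m. t a * finner n M (outer (c a)))" for M
    unfolding Z_def by (rule finner_sum)
  have s: "s = (\<Sum>a<n - m. (t a)\<^sup>2)"
    unfolding s_def t_def using m
    by (intro sum.reindex_bij_witness[of _ "\<lambda>a. m + a" "\<lambda>j. j - m"]) auto
  have Zx: "finner n Z (outer x) = (\<Sum>a<n - m. t a * (dot n x (c a))\<^sup>2)" for x
    by (simp add: finner_commute[of n Z] Z finner_outer_outer)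
  show thesis
  proof
    show "0 \<le> finner n M Z" if "\<And>x. 0 \<le> finner n M (outer x)" for M
      unfolding Z using that t by (intro sum_nonneg mult_nonneg_nonneg)
    show "0 \<le> finner n Z (outer x)" for x
      unfolding Zx using t by (intro sum_nonneg mult_nonneg_nonneg) auto
    show "finner n Z (outer (w k)) = 0" if "k < m" for k
      unfolding Zx using c(2) that by (intro sum.neutral) auto
    \<comment> \<open>The quadratic form at the unit vector \<open>c a\<close> averages eigenvalues
      with index at most m + a, so it is at least \<open>lam (m + a)\<close>. Multiplying by
      \<open>t a\<close> suffices, because a positive part times its number is the square of the
      positive part.\<close>
    have "(t a)\<^sup>2 \<le> t a * finner n (diag lam) (outer (c a))" if a: "a < n - m" for a
    proof -
      have "lam (m + a) = lam (m + a) * dot n (c a) (c a)" using c(3) a by simp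
      also have "\<dots> = (\<Sum>i<n. lam (m + a) * (c a i)\<^sup>2)"
        by (simp add: dot_def sum_distrib_left power2_eq_square)
      also have "\<dots> \<le> (\<Sum>i<n. lam i * (c a i)\<^sup>2)"
      proof (intro sum_mono)
        fix i assume "i \<in> {..<n}"
        show "lam (m + a) * (c a i)\<^sup>2 \<le> lam i * (c a i)\<^sup>2"
          using c(1)[OF a] monotone_onD[OF desc, of i "m + a"] a m
          by (cases "i > m + a") (auto intro!: mult_right_mono)
      qed
      finally have "t a * lam (m + a) \<le> t a * finner n (diag lam) (outer (c a))"
        unfolding finner_diag_outer using t by (intro mult_left_mono)
      thus ?thesis by (simp add: t_def power2_eq_square max_def split: if_splits)
    qed
    thus "s \<le> finner n (diag lam) Z"
      unfolding s Z by (intro sum_mono) simp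
    \<comment> \<open>By orthonormality only the summand of \<open>c a\<close> itself
      survives.\<close>
    have "finner n Z (outer (c a)) = t a" if "a < n - m" for a
      unfolding Zx using that c(3) by (simp add: if_distrib[of "\<lambda>u. _ * u\<^sup>2"] cong: if_cong)
    thus "finner n Z Z = s"
      unfolding s Z by (simp add: power2_eq_square)
  qed
qed

text \<open>Index reversal is an involution of the range below n, so it can be moved from one factor
  to the other.\<close>

lemma finner_reverse:
  "finner n M (\<lambda>i j. N (n - Suc i) (n - Suc j)) = finner n (\<lambda>i j. M (n - Suc i) (n - Suc j)) N"
proof -
  have "finner n M (\<lambda>i j. N (n - Suc i) (n - Suc j)) =
      (\<Sum>i<n. \<Sum>j<n. M (n - Suc (n - Suc i)) (n - Suc (n - Suc j)) * N (n - Suc i) (n - Suc j))"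
    by (simp add: finner_def)
  also have "\<dots> = (\<Sum>i<n. \<Sum>j<n. M (n - Suc (n - Suc i)) (n - Suc j) * N (n - Suc i) j)"
    by (intro sum.cong refl sum.nat_diff_reindex)
  also have "\<dots> = (\<Sum>i<n. \<Sum>j<n. M (n - Suc i) (n - Suc j) * N i j)"
    by (rule sum.nat_diff_reindex)
  finally show ?thesis by (simp add: finner_def)
qed

text \<open>Negating and reversing a decreasing sequence gives a decreasing one, so the positive
  case applies to \<open>mu\<close>. Its indices from m to n - 1 correspond to the first n - m
  indices of \<open>lam\<close>: now the m smallest eigenvalues are given up.\<close>

lemma compressed_negative_part:
  fixes w :: "nat \<Rightarrow> nat \<Rightarrow> real"
  assumes desc: "antimono_on {..<n} lam" and m: "m \<le> n"
  defines "s \<equiv> (\<Sum>j<n - m. (max (- lam j) 0)\<^sup>2)"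
  obtains Z where
    "\<And>x. 0 \<le> finner n Z (outer x)"
    "\<And>k. k < m \<Longrightarrow> finner n Z (outer (w k)) = 0"
    "s \<le> - finner n (diag lam) Z"
    "finner n Z Z = s"
proof -
  define r where "r i = n - Suc i" for i
  define mu where "mu i = - lam (r i)" for i
  have s: "s = (\<Sum>j=m..<n. (max (mu j) 0)\<^sup>2)"
    unfolding s_def mu_def r_def using m
    by (intro sum.reindex_bij_witness[of _ "\<lambda>j. n - Suc j" "\<lambda>j. n - Suc j"]) auto
  have mu_desc: "antimono_on {..<n} mu"
    using monotone_onD[OF desc] by (intro monotone_onI) (auto simp: mu_def r_def)
  obtain Y where Y: "\<And>x. 0 \<le> finner n Y (outer x)"
    "\<And>k. k < m \<Longrightarrow> finner n Y (outer (\<lambda>i. w k (r i))) = 0"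
    "s \<le> finner n (diag mu) Y" "finner n Y Y = s"
    unfolding s by (rule compressed_positive_part[where w = "\<lambda>k i. w k (r i)", OF mu_desc m]) blast+
  define Z where "Z = (\<lambda>i j. Y (r i) (r j))"
  have Z: "finner n M Z = finner n (\<lambda>i j. M (r i) (r j)) Y" for M
    unfolding Z_def r_def by (rule finner_reverse)
  have Zx: "finner n Z (outer x) = finner n Y (outer (\<lambda>i. x (r i)))" for x
    unfolding finner_commute[of n Z] Z by (simp add: outer_def finner_commute)
  show thesis
  proof
    show "0 \<le> finner n Z (outer x)" for x unfolding Zx by (rule Y(1))
    show "finner n Z (outer (w k)) = 0" if "k < m" for k unfolding Zx by (rule Y(2)[OF that])
    have "finner n (\<lambda>i j. diag lam (r i) (r j)) Y = - finner n (diag mu) Y"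
      unfolding finner_def sum_negf[symmetric]
      by (intro sum.cong refl) (auto simp: diag_def mu_def r_def)
    thus "s \<le> - finner n (diag lam) Z" using Y(3) by (simp add: Z)
    have "finner n (\<lambda>i j. Z (r i) (r j)) Y = finner n Y Y"
      unfolding finner_def by (intro sum.cong refl) (auto simp: Z_def r_def)
    thus "finner n Z Z = s" using Y(4) by (simp add: Z)
  qed
qed

text \<open>An Eckart-Young bound with prescribed signature: one positive rank-one term can absorb
  at most one positive eigenvalue, and d negative ones at most d negative eigenvalues.\<close>

lemma diag_signature_approximation_bound:
  fixes u :: "nat \<Rightarrow> real" and v :: "nat \<Rightarrow> nat \<Rightarrow> real"
  assumes desc: "antimono_on {..<n} lam" and d: "d \<le> n" and n: "1 \<le> n"
  defines "B \<equiv> (\<lambda>i j. diag lam i j - outer u i j + (\<Sum>k<d. outer (v k) i j))"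
  shows "(\<Sum>j=1..<n. (max (lam j) 0)\<^sup>2) + (\<Sum>j<n - d. (max (- lam j) 0)\<^sup>2) \<le> finner n B B"
    (is "?a + ?b \<le> _")
proof -
  obtain P where P: "\<And>M. (\<And>x. 0 \<le> finner n M (outer x)) \<Longrightarrow> 0 \<le> finner n M P"
    "\<And>x. 0 \<le> finner n P (outer x)" "finner n P (outer u) = 0"
    "?a \<le> finner n (diag lam) P" "finner n P P = ?a"
    by (rule compressed_positive_part[where w = "\<lambda>_. u", OF desc n]) blast+
  obtain N where N: "\<And>x. 0 \<le> finner n N (outer x)"
    "\<And>k. k < d \<Longrightarrow> finner n N (outer (v k)) = 0"
    "?b \<le> - finner n (diag lam) N" "finner n N N = ?b"
    by (rule compressed_negative_part[where w = v, OF desc d]) blast+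
  have B: "finner n B M = finner n (diag lam) M - finner n M (outer u)
      + (\<Sum>k<d. finner n M (outer (v k)))" for M
    using finner_sum[where t = "\<lambda>_. 1" and S = "{..<d}" and N = "\<lambda>k. outer (v k)" and n = n and M = M]
    unfolding B_def finner_commute[of n _ M] by (simp add: finner_add finner_diff)
  define Z where "Z = (\<lambda>i j. P i j - N i j)"
  \<comment> \<open>Against P the \<open>u\<close> term vanishes and the \<open>v k\<close> terms
    are nonnegative; against N the \<open>v k\<close> terms vanish and the \<open>u\<close> term has
    the favourable sign.\<close>
  have BP: "?a \<le> finner n B P" unfolding B using P by (simp add: sum_nonneg add_increasing2)
  have "finner n B N \<le> - ?b" unfolding B using N(1)[of u] N(2,3) by simp
  \<comment> \<open>N is nonnegative on every \<open>outer x\<close> and P lies in their cone. Hence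
    the cross term can only decrease the squared norm of P - N.\<close>
  moreover have "0 \<le> finner n N P" using P(1) N(1) by blast
  moreover have "finner n Z Z = ?a - 2 * finner n N P + ?b"
    using P(5) N(4) unfolding Z_def
    by (simp add: finner_diff finner_commute[of _ "\<lambda>i j. P i j - N i j"])
      (simp add: finner_commute[of n P N])
  moreover have "finner n B Z = finner n B P - finner n B N"
    unfolding Z_def by (rule finner_diff)
  ultimately show ?thesis using BP finner_self_lower_bound[of n B Z] by linarith
qed

section \<open>The strain in eigenbasis coordinates\<close>

definition frob_sq :: "real mat \<Rightarrow> real" where
  "frob_sq M = (\<Sum>i<dim_row M. \<Sum>j<dim_col M. (M $$ (i, j))\<^sup>2)"

lemma frob_sq_transpose: "frob_sq (transpose_mat M) = frob_sq M"
  unfolding frob_sq_def by (subst sum.swap) (intro sum.cong; simp)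

text \<open>The squared norm is the trace of the Gram matrix of the columns, and Q cancels from the
  Gram matrix of \<open>Q * M\<close>.\<close>

lemma frob_sq_orthogonal_mult:
  assumes Q: "Q \<in> carrier_mat n n" "transpose_mat Q * Q = 1\<^sub>m n" and M: "M \<in> carrier_mat n m"
  shows "frob_sq (Q * M) = frob_sq M"
proof -
  have gram: "frob_sq C = (\<Sum>j<m. (transpose_mat C * C) $$ (j, j))" if "C \<in> carrier_mat n m" for C
    using that unfolding frob_sq_def
    by (subst sum.swap) (auto simp: scalar_prod_def power2_eq_square atLeast0LessThan intro!: sum.cong)
  have "transpose_mat (Q * M) * (Q * M) = transpose_mat M * transpose_mat Q * (Q * M)"
    using transpose_mult[OF Q(1) M] by simp
  also have "\<dots> = transpose_mat M * (transpose_mat Q * Q * M)"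
    using Q(1) M by (simp add: assoc_mult_mat[of _ m n _ n _ m] assoc_mult_mat[of _ n n _ n _ m])
  also have "\<dots> = transpose_mat M * M" using Q(2) M by simp
  finally show ?thesis using gram[OF M] gram[of "Q * M"] Q(1) M by simp
qed

lemma frob_sq_orthogonal_conjugate:
  assumes Q: "Q \<in> carrier_mat n n" "transpose_mat Q * Q = 1\<^sub>m n" and M: "M \<in> carrier_mat n n"
  shows "frob_sq (Q * M * transpose_mat Q) = frob_sq M"
proof -
  have "transpose_mat (Q * M * transpose_mat Q) = Q * transpose_mat (Q * M)"
    using Q(1) M by (subst transpose_mult[of _ n n _ n]) auto
  hence "frob_sq (Q * M * transpose_mat Q) = frob_sq (Q * transpose_mat (Q * M))"
    by (metis frob_sq_transpose)
  also have "\<dots> = frob_sq (Q * M)"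
    using frob_sq_orthogonal_mult[OF Q, of "transpose_mat (Q * M)" n] Q(1) M
    by (simp add: frob_sq_transpose)
  finally show ?thesis using frob_sq_orthogonal_mult[OF Q M] by simp
qed

text \<open>Conjugating diag(1, -1, ..., -1) by V yields the Lorentz products of the rows of V. This
  serves both for the configuration and for its eigenbasis coordinates.\<close>

lemma minkowski_gram_entry:
  fixes V :: "real mat"
  assumes V: "V \<in> carrier_mat n (Suc d)" and ij: "i < n" "j < n"
  shows "(V * mat_diag (Suc d) (\<lambda>k. if k = 0 then 1 else - 1) * transpose_mat V) $$ (i, j) =
    V $$ (i, 0) * V $$ (j, 0) - (\<Sum>k<d. V $$ (i, Suc k) * V $$ (j, Suc k))"
proof -
  have "(V * mat_diag (Suc d) (\<lambda>k. if k = 0 then 1 else - 1) * transpose_mat V) $$ (i, j) =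
    (\<Sum>k<Suc d. V $$ (i, k) * (if k = 0 then 1 else - 1) * V $$ (j, k))"
    using V ij unfolding mat_diag_mult_right[OF V]
    by (auto simp: scalar_prod_def atLeast0LessThan intro!: sum.cong)
  also have "\<dots> = V $$ (i, 0) * V $$ (j, 0) + (\<Sum>k<d. - (V $$ (i, Suc k) * V $$ (j, Suc k)))"
    by (subst sum.lessThan_Suc_shift) simp
  finally show ?thesis by (simp add: sum_negf)
qed

text \<open>With configuration matrix QV and J = diag(1, -1, ..., -1), the residual A - (QV) J
  (QV)^T is the conjugate by Q of \<Lambda> - V J V^T, so both have the same Frobenius norm.\<close>

lemma strain_in_eigenbasis:
  assumes eig: "ordered_eigendecomposition n (cosh_mat \<kappa> D) Q lam"
    and D: "D \<in> carrier_mat n n" and V: "V \<in> carrier_mat n (Suc d)"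
    and y: "\<And>i. i < n \<Longrightarrow> y i \<in> carrier_vec (Suc d)"
    and yV: "\<And>i k. i < n \<Longrightarrow> k < Suc d \<Longrightarrow> y i $ k = (Q * V) $$ (i, k)"
  defines "B \<equiv> (\<lambda>i j. diag lam i j - outer (\<lambda>i. V $$ (i, 0)) i j
      + (\<Sum>k<d. outer (\<lambda>i. V $$ (i, Suc k)) i j))"
  shows "strain \<kappa> n D y = finner n B B"
proof -
  have Q: "Q \<in> carrier_mat n n" "transpose_mat Q * Q = 1\<^sub>m n"
    and A: "cosh_mat \<kappa> D = Q * mat_diag n lam * transpose_mat Q"
    using eig by (auto simp: ordered_eigendecomposition_def)
  define J :: "real mat" where "J = mat_diag (Suc d) (\<lambda>k. if k = 0 then 1 else - 1)"
  have J: "J \<in> carrier_mat (Suc d) (Suc d)" by (simp add: J_def)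
  define M where "M = mat_diag n lam - V * J * transpose_mat V"
  have M: "M \<in> carrier_mat n n"
    unfolding M_def using V J by (intro minus_carrier_mat mult_carrier_mat[of _ _ "Suc d"]) auto
  have QV: "Q * V \<in> carrier_mat n (Suc d)" using Q V by simp
  have "Q * M * transpose_mat Q =
      cosh_mat \<kappa> D - Q * (V * J * transpose_mat V) * transpose_mat Q"
    unfolding A M_def using Q(1) V J
    by (simp add: mult_minus_distrib_mat[of _ n n _ n] minus_mult_distrib_mat[of _ n n _ _ n])
  also have "Q * (V * J * transpose_mat V) * transpose_mat Q = (Q * V) * J * transpose_mat (Q * V)"
  proof -
    have "Q * (V * J * transpose_mat V) * transpose_mat Q = Q * (V * J) * transpose_mat V * transpose_mat Q"
      using Q(1) V J by (simp add: assoc_mult_mat[of Q n n "V * J" "Suc d" "transpose_mat V" n])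
    also have "\<dots> = Q * V * J * transpose_mat V * transpose_mat Q"
      using Q(1) V J by (simp add: assoc_mult_mat[of Q n n V "Suc d" J "Suc d"])
    also have "\<dots> = Q * V * J * (transpose_mat V * transpose_mat Q)"
      using Q(1) V J by (intro assoc_mult_mat[of _ n "Suc d" _ n _ n]) auto
    finally show ?thesis using transpose_mult[OF Q(1) V] by simp
  qed
  finally have conj: "Q * M * transpose_mat Q = cosh_mat \<kappa> D - (Q * V) * J * transpose_mat (Q * V)" .
  have entry: "cosh (sqrt \<kappa> * D $$ (i, j)) - y i \<circ>\<^sub>L y j = (Q * M * transpose_mat Q) $$ (i, j)"
    if ij: "i < n" "j < n" for i j
  proof -
    have "y i \<circ>\<^sub>L y j = y i $ 0 * y j $ 0 - (\<Sum>k<d. y i $ Suc k * y j $ Suc k)"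
      using y[OF ij(1)] unfolding lorentz_prod_def
      by (simp add: sum.shift_bounds_Suc_ivl[of _ 0] atLeast0LessThan del: sum.op_ivl_Suc)
    also have "\<dots> = ((Q * V) * J * transpose_mat (Q * V)) $$ (i, j)"
      unfolding J_def minkowski_gram_entry[OF QV ij] using ij by (simp add: yV del: index_mult_mat)
    finally have "y i \<circ>\<^sub>L y j = (Q * V * J * transpose_mat (Q * V)) $$ (i, j)" .
    moreover have "Q * V * J * transpose_mat (Q * V) \<in> carrier_mat n n"
      by (rule mult_carrier_mat[OF mult_carrier_mat[OF QV J] transpose_carrier_mat[THEN iffD2, OF QV]])
    ultimately show ?thesis
      unfolding conj using ij D by (subst index_minus_mat) (auto simp: cosh_mat_def)
  qed
  have "strain \<kappa> n D y = frob_sq (Q * M * transpose_mat Q)"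
    unfolding strain_def frob_sq_def using Q(1) M by (intro sum.cong) (auto simp: entry)
  also have "\<dots> = frob_sq M" by (rule frob_sq_orthogonal_conjugate[OF Q M])
  also have "\<dots> = finner n B B"
  proof -
    have "M $$ (i, j) = B i j" if ij: "i < n" "j < n" for i j
      using minkowski_gram_entry[OF V ij] V J ij unfolding M_def B_def J_def
      by (simp add: mat_diag_def diag_def outer_def del: index_mult_mat(1))
    thus ?thesis using M by (auto simp: frob_sq_def finner_def power2_eq_square intro!: sum.cong)
  qed
  finally show ?thesis .
qed

lemma strain_lower_bound:
  assumes eig: "ordered_eigendecomposition n (cosh_mat \<kappa> D) Q lam"
    and D: "D \<in> carrier_mat n n" and d: "d \<le> n" and n: "1 \<le> n"
    and y: "\<And>i. i < n \<Longrightarrow> y i \<in> lorentz_space d"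
  shows "(\<Sum>j=1..<n. (max (lam j) 0)\<^sup>2) + (\<Sum>j<n - d. (max (- lam j) 0)\<^sup>2) \<le> strain \<kappa> n D y"
proof -
  have Q: "Q \<in> carrier_mat n n" "transpose_mat Q * Q = 1\<^sub>m n"
    and desc: "antimono_on {..<n} lam"
    using eig by (auto simp: ordered_eigendecomposition_def monotone_on_def)
  have QQ: "Q * transpose_mat Q = 1\<^sub>m n"
    using mat_mult_left_right_inverse[OF _ Q(1) Q(2)] Q(1) by simp
  define U where "U = mat n (Suc d) (\<lambda>(i, k). y i $ k)"
  have U: "U \<in> carrier_mat n (Suc d)" by (simp add: U_def)
  \<comment> \<open>Every configuration U has eigenbasis coordinates Q^T U, so the bound for
    diagonal matrices covers all competitors.\<close>
  have "Q * (transpose_mat Q * U) = U"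
    using assoc_mult_mat[of Q n n "transpose_mat Q" n U "Suc d"] Q(1) U QQ by simp
  hence "y i $ k = (Q * (transpose_mat Q * U)) $$ (i, k)" if "i < n" "k < Suc d" for i k
    using that by (simp add: U_def)
  moreover have "y i \<in> carrier_vec (Suc d)" if "i < n" for i
    using y[OF that] by (simp add: lorentz_space_def)
  moreover have "transpose_mat Q * U \<in> carrier_mat n (Suc d)" using Q(1) U by simp
  ultimately show ?thesis
    using strain_in_eigenbasis[OF eig D] diag_signature_approximation_bound[OF desc d n] by simp
qed

section \<open>The value attained by hydra, and positivity\<close>

lemma strain_hydra_mat:
  assumes eig: "ordered_eigendecomposition n (cosh_mat \<kappa> D) Q lam"
    and D: "D \<in> carrier_mat n n" and d: "d < n" and lam0: "0 \<le> lam 0"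
  shows "strain \<kappa> n D (row (hydra_mat n d Q lam)) =
    (\<Sum>j=1..<n. (max (lam j) 0)\<^sup>2) + (\<Sum>j<n - d. (max (- lam j) 0)\<^sup>2)"
proof -
  have Q: "Q \<in> carrier_mat n n"
    using eig by (auto simp: ordered_eigendecomposition_def)
  define s where "s k = (if k = 0 then sqrt (lam 0) else sqrt (max (- lam (n - d + k - 1)) 0))" for k
  \<comment> \<open>\<open>p k\<close> is the index of the eigenvector in column k, so column k of V
    is \<open>s k\<close> times a standard basis vector. As d < n, the space-like columns never
    reuse index 0, and the residual is diagonal.\<close>
  define p where "p k = (if k = 0 then 0 else n - d + k - 1)" for k
  define V where "V = mat n (Suc d) (\<lambda>(i, k). if i = p k then s k else 0)"
  have V: "V \<in> carrier_mat n (Suc d)" by (simp add: V_def)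
  have p: "p k < n" if "k < Suc d" for k using that d by (auto simp: p_def)
  have QV: "row (hydra_mat n d Q lam) i $ k = (Q * V) $$ (i, k)" if "i < n" "k < Suc d" for i k
  proof -
    have "(Q * V) $$ (i, k) = (\<Sum>j<n. Q $$ (i, j) * (if j = p k then s k else 0))"
      using that Q by (auto simp: V_def scalar_prod_def atLeast0LessThan intro!: sum.cong)
    also have "\<dots> = Q $$ (i, p k) * s k"
      using p[OF that(2)] by (simp add: if_distrib[of "\<lambda>u. _ * u"] cong: if_cong)
    also have "\<dots> = row (hydra_mat n d Q lam) i $ k"
      using that by (simp add: hydra_mat_def p_def s_def)
    finally show ?thesis by simp
  qed
  define B where "B = (\<lambda>i j. diag lam i j - outer (\<lambda>i. V $$ (i, 0)) i j
      + (\<Sum>k<d. outer (\<lambda>i. V $$ (i, Suc k)) i j))"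
  have strain: "strain \<kappa> n D (row (hydra_mat n d Q lam)) = finner n B B"
    unfolding B_def by (rule strain_in_eigenbasis[OF eig D V _ QV])
      (auto simp: hydra_mat_def)
  have off: "B i j = 0" if "i < n" "j < n" "i \<noteq> j" for i j
    using that by (auto simp: B_def diag_def outer_def V_def p_def intro!: sum.neutral)
  \<comment> \<open>At i = 0 the time-like column cancels \<open>lam 0\<close>. For i at least n - d
    the negative part is cancelled, leaving the positive part. For the other i the entry is
    \<open>lam i\<close>, whose square is the sum of the squares of its two parts.\<close>
  have on: "(B i i)\<^sup>2 = (if 1 \<le> i then (max (lam i) 0)\<^sup>2 else 0)
      + (if i < n - d then (max (- lam i) 0)\<^sup>2 else 0)" if i: "i < n" for i
  proof -
    have "(\<Sum>k<d. outer (\<lambda>i. V $$ (i, Suc k)) i i) =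
        (\<Sum>k<d. if n - d \<le> i \<and> k = i - (n - d) then max (- lam i) 0 else 0)"
      using i by (intro sum.cong) (auto simp: outer_def V_def p_def s_def)
    also have "\<dots> = (if n - d \<le> i then max (- lam i) 0 else 0)"
      using i d by (auto intro: sum.neutral)
    finally have "B i i = lam i - (if i = 0 then lam 0 else 0)
        + (if n - d \<le> i then max (- lam i) 0 else 0)"
      using i lam0 by (auto simp: B_def diag_def outer_def V_def p_def s_def)
    thus ?thesis using d lam0 by (cases "i = 0") (auto simp: max_def)
  qed
  have "finner n B B = (\<Sum>i<n. (B i i)\<^sup>2)"
    unfolding finner_def
  proof (intro sum.cong refl)
    fix i assume i: "i \<in> {..<n}"
    have "(\<Sum>j<n. B i j * B i j) = (\<Sum>j\<in>{i}. B i j * B i j)"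
      using i off by (intro sum.mono_neutral_right) auto
    thus "(\<Sum>j<n. B i j * B i j) = (B i i)\<^sup>2" by (simp add: power2_eq_square)
  qed
  also have "\<dots> = (\<Sum>i<n. if 1 \<le> i then (max (lam i) 0)\<^sup>2 else 0)
      + (\<Sum>i<n. if i < n - d then (max (- lam i) 0)\<^sup>2 else 0)"
    using on by (simp add: sum.distrib)
  also have "(\<Sum>i<n. if 1 \<le> i then (max (lam i) 0)\<^sup>2 else 0) = (\<Sum>j=1..<n. (max (lam j) 0)\<^sup>2)"
    by (intro sum.mono_neutral_cong_right) auto
  also have "(\<Sum>i<n. if i < n - d then (max (- lam i) 0)\<^sup>2 else 0) = (\<Sum>j<n - d. (max (- lam j) 0)\<^sup>2)"
    by (intro sum.mono_neutral_cong_right) auto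
  finally show ?thesis using strain by simp
qed

lemma perron_eigenvector_pos:
  assumes eig: "ordered_eigendecomposition n A Q lam"
    and A: "\<And>i j. i < n \<Longrightarrow> j < n \<Longrightarrow> 0 < A $$ (i, j)"
    and q: "\<And>i. i < n \<Longrightarrow> 0 \<le> Q $$ (i, 0)" and i: "i < n"
  shows "0 < lam 0" "0 < Q $$ (i, 0)"
proof -
  have n: "0 < n" using i by simp
  have Q: "Q \<in> carrier_mat n n" "transpose_mat Q * Q = 1\<^sub>m n"
    and Adec: "A = Q * mat_diag n lam * transpose_mat Q"
    using eig by (auto simp: ordered_eigendecomposition_def)
  have Ac: "A \<in> carrier_mat n n"
    using Q(1) unfolding Adec by (intro mult_carrier_mat[of _ n n]) auto
  have "A * Q = Q * mat_diag n lam * (transpose_mat Q * Q)"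
    unfolding Adec using Q(1) by (intro assoc_mult_mat[of _ n n _ n _ n]) auto
  also have "\<dots> = Q * mat_diag n lam" using Q(2) right_mult_one_mat[OF mult_carrier_mat[OF Q(1) mat_diag_dim]] by simp
  finally have "(A * Q) $$ (i, 0) = Q $$ (i, 0) * lam 0"
    unfolding mat_diag_mult_right[OF Q(1)] using i n by simp
  moreover have "(A * Q) $$ (i, 0) = (\<Sum>j<n. A $$ (i, j) * Q $$ (j, 0))"
    using i n Ac Q(1) by (auto simp: scalar_prod_def atLeast0LessThan intro!: sum.cong)
  ultimately have eq: "Q $$ (i, 0) * lam 0 = (\<Sum>j<n. A $$ (i, j) * Q $$ (j, 0))" by simp
  \<comment> \<open>The first eigenvector has norm 1, hence a nonzero entry j; as A is entrywise
    positive, the j-th summand alone makes entry i of A q_0 positive.\<close>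
  have "(transpose_mat Q * Q) $$ (0, 0) = (\<Sum>j<n. Q $$ (j, 0) * Q $$ (j, 0))"
    using n Q(1) by (auto simp: scalar_prod_def atLeast0LessThan intro!: sum.cong)
  hence "(\<Sum>j<n. Q $$ (j, 0) * Q $$ (j, 0)) = 1" using Q(2) n by simp
  then obtain j where j: "j < n" "Q $$ (j, 0) \<noteq> 0"
    by (metis (no_types, lifting) lessThan_iff mult_zero_left sum.neutral zero_neq_one)
  have "0 < A $$ (i, j) * Q $$ (j, 0)" using A[OF i j(1)] q[OF j(1)] j(2) by simp
  also have "\<dots> \<le> (\<Sum>j<n. A $$ (i, j) * Q $$ (j, 0))"
    using j(1) A[OF i] q by (intro member_le_sum) (auto simp: less_imp_le)
  finally have "0 < Q $$ (i, 0) * lam 0" using eq by simp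
  with q[OF i] show "0 < lam 0" "0 < Q $$ (i, 0)"
    by (auto simp: zero_less_mult_iff)
qed

theorem theorem3p2:
  fixes n d :: nat and \<kappa> :: real and D X :: "real mat"
  assumes "d \<ge> 1" and "d \<le> n - 1" and "\<kappa> > 0"
    and "D \<in> carrier_mat n n"
    and "\<And>i j. i < n \<Longrightarrow> j < n \<Longrightarrow> D $$ (i, j) \<ge> 0"
    and "transpose_mat D = D"
    and "\<And>i. i < n \<Longrightarrow> D $$ (i, i) = 0"
    and "hydra n D d \<kappa> X"
  shows "is_arg_min (strain \<kappa> n D) (\<lambda>y. \<forall>i<n. y i \<in> lorentz_space d) (row X)
    \<and> (\<forall>i<n. col X 0 $ i > 0)
    \<and> (\<forall>i<n. row X i \<in> pos_lorentz_space d)"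
proof -
  obtain Q lam where eig: "ordered_eigendecomposition n (cosh_mat \<kappa> D) Q lam"
    and q: "\<And>i. i < n \<Longrightarrow> 0 \<le> Q $$ (i, 0)" and X: "X = hydra_mat n d Q lam"
    using assms(8) by (auto simp: hydra_def)
  \<comment> \<open>Natural subtraction truncates: n = 0 would force d = 0, contrary to d \<ge>
    1.\<close>
  have dn: "d < n" using assms(1,2) by simp
  have "0 < cosh_mat \<kappa> D $$ (i, j)" if "i < n" "j < n" for i j
    using that assms(4) by (simp add: cosh_mat_def)
  note pos = perron_eigenvector_pos[OF eig this q]
  have lam0: "0 < lam 0" using pos(1)[of 0] dn by simp
  have X0: "0 < X $$ (i, 0)" if "i < n" for i
    using pos(2)[OF _ _ _ that] lam0 that by (simp add: X hydra_mat_def)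
  have Xc: "X \<in> carrier_mat n (d + 1)" by (simp add: X hydra_mat_def)
  have row: "row X i \<in> lorentz_space d" if "i < n" for i
    using Xc that by (simp add: lorentz_space_def)
  \<comment> \<open>The value attained by hydra is exactly the lower bound, for the same
    eigendecomposition.\<close>
  have "strain \<kappa> n D (row X) \<le> strain \<kappa> n D y" if "\<forall>i<n. y i \<in> lorentz_space d" for y
    using strain_hydra_mat[OF eig assms(4) dn] strain_lower_bound[OF eig assms(4), of d y]
      lam0 dn that by (simp add: X)
  hence "is_arg_min (strain \<kappa> n D) (\<lambda>y. \<forall>i<n. y i \<in> lorentz_space d) (row X)"
    unfolding is_arg_min_def using row by (auto simp: not_less)
  thus ?thesis using X0 row Xc by (auto simp: pos_lorentz_space_def)
qed

end
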